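(* Let $\theta\in(3/2,2)$. Then either $\theta^{-1}$ is a multinacci number or $$\ell(\theta)\le\frac{2}{2+\theta}<\frac1\theta.$$
   Context: For $\theta>1$, $$\ell(\theta):=\inf\left\{|\rho| : \rho=\sum_{k=0}^n s_k\theta^k\neq0,\ s_k\in\{0,\pm1\},\ n\ge1\right\}.$$ For $m\ge2$ the multinacci number $\omega_m$ is the unique positive root of $x^m+x^{m-1}+\cdots+x=1$; a real number is called multinacci if it equals $\omega_m$ for some integer $m\ge2$. *)

theory Defs
  imports Complex_Main
begin

definition ell :: "real \<Rightarrow> real" where
  "ell \<theta> = Inf {\<bar>\<rho>\<bar> | \<rho>. \<rho> \<noteq> 0 \<and>
     (\<exists>(n::nat) (s::nat \<Rightarrow> real). n \<ge> 1 \<and> (\<forall>k\<le>n. s k \<in> {-1, 0, 1}) \<and>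
        \<rho> = (\<Sum>k=0..n. s k * \<theta> ^ k))}"

text \<open>\<open>Inf\<close> on the reals is the genuine infimum only for nonempty sets that are bounded below.\<close>

lemma ell_set_nonempty:
  "{\<bar>\<rho>\<bar> | \<rho>. \<rho> \<noteq> 0 \<and>
     (\<exists>(n::nat) (s::nat \<Rightarrow> real). n \<ge> 1 \<and> (\<forall>k\<le>n. s k \<in> {-1, 0, 1}) \<and>
        \<rho> = (\<Sum>k=0..n. s k * (\<theta>::real) ^ k))} \<noteq> {}"
proof -
  have "(1::real) = (\<Sum>k=0..1. (if k = 0 then 1 else 0) * \<theta> ^ k)"
    by simp
  moreover have "\<forall>k\<le>1::nat. (if k = 0 then 1 else 0 :: real) \<in> {-1, 0, 1}"
    by simp
  ultimately have "\<exists>(n::nat) (s::nat \<Rightarrow> real). n \<ge> 1 \<and> (\<forall>k\<le>n. s k \<in> {-1, 0, 1}) \<and>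
        (1::real) = (\<Sum>k=0..n. s k * \<theta> ^ k)"
    by (intro exI[of _ "1::nat"] exI[of _ "\<lambda>k::nat. if k = 0 then 1 else 0 :: real"] conjI order_refl)
  then show ?thesis
    by (intro ex_in_conv[THEN iffD1] exI[of _ "\<bar>1::real\<bar>"] CollectI exI[of _ "1::real"] conjI
      refl one_neq_zero)
qed

lemma ell_set_bdd_below:
  "bdd_below {\<bar>\<rho>\<bar> | \<rho>. \<rho> \<noteq> 0 \<and>
     (\<exists>(n::nat) (s::nat \<Rightarrow> real). n \<ge> 1 \<and> (\<forall>k\<le>n. s k \<in> {-1, 0, 1}) \<and>
        \<rho> = (\<Sum>k=0..n. s k * (\<theta>::real) ^ k))}"
  by (rule bdd_belowI[of _ 0]) auto

definition multinacci :: "nat \<Rightarrow> real" where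
  "multinacci m = (THE x. x > 0 \<and> (\<Sum>k=1..m. x ^ k) = 1)"

lemma multinacci_ex1:
  assumes "m \<ge> 2"
  shows "\<exists>!x::real. x > 0 \<and> (\<Sum>k=1..m. x ^ k) = 1"
proof -
  let ?f = "\<lambda>x::real. \<Sum>k=1..m. x ^ k"
  have mono: "?f x < ?f y" if "0 < x" "x < y" for x y
    using assms that by (intro sum_strict_mono power_strict_mono) auto
  have "?f 0 \<le> 1"
    by (simp add: power_0_left)
  moreover have "1 \<le> ?f 1"
    using assms by simp
  moreover have "\<forall>x. 0 \<le> x \<and> x \<le> 1 \<longrightarrow> isCont ?f x"
    by (intro allI impI continuous_intros)
  ultimately obtain x where x: "0 \<le> x" "?f x = 1"
    using IVT[of ?f 0 1 1] by auto
  have "x \<noteq> 0"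
    using x(2) by (auto simp: power_0_left)
  with x have "x > 0 \<and> ?f x = 1"
    by simp
  moreover have "y = z" if "y > 0 \<and> ?f y = 1" "z > 0 \<and> ?f z = 1" for y z
    using mono[of y z] mono[of z y] that by (cases y z rule: linorder_cases) auto
  ultimately show ?thesis
    by blast
qed

definition is_multinacci :: "real \<Rightarrow> bool" where
  "is_multinacci x \<longleftrightarrow> (\<exists>m\<ge>2. x = multinacci m)"

end

theory Submission
  imports Defs
begin

text \<open>
  The values \<open>\<theta>^n - (1 + \<theta> + \<dots> + \<theta>^(n-1))\<close> form the orbit of \<open>1\<close> under the expanding
  map \<open>x \<mapsto> \<theta> * x - 1\<close>, and for \<open>n \<ge> 1\<close> each of them is a sum admitted in the definition of
  \<^const>\<open>ell\<close>. The fixed point \<open>1 / (\<theta> - 1)\<close> of the map lies above the starting value \<open>1\<close>, so the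
  orbit decreases without bound (\<open>multinacci_orbit_le\<close>) and has to pass the zero \<open>1 / \<theta>\<close> of
  the map.

  If it hits \<open>1 / \<theta>\<close>, then \<open>\<theta>\<close> satisfies the equation that makes \<open>1 / \<theta>\<close> a multinacci
  number (\<open>is_multinacci_if_orbit_eq\<close>). Otherwise let \<open>x\<close> be the first value below \<open>1 / \<theta>\<close>.
  Its predecessor lies above the zero of the map, so \<open>0 < x < 1 / \<theta>\<close>; hence both \<open>x\<close> and the next
  value, of modulus \<open>1 - \<theta> * x > 0\<close>, are nonzero. As \<open>\<theta> * x + (1 - \<theta> * x) = 1\<close> is a sum of
  moduli with weights \<open>\<theta>\<close> and \<open>1\<close>, one of the two moduli is at most \<open>1 / (1 + \<theta>)\<close>, and this
  is smaller than \<open>2 / (2 + \<theta>)\<close>.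
\<close>

definition multinacci_orbit :: "real \<Rightarrow> nat \<Rightarrow> real" where
  "multinacci_orbit \<theta> n = \<theta> ^ n - (\<Sum>k<n. \<theta> ^ k)"

lemma multinacci_orbit_0 [simp]: "multinacci_orbit \<theta> 0 = 1"
  by (simp add: multinacci_orbit_def)

lemma multinacci_orbit_Suc: "multinacci_orbit \<theta> (Suc n) = \<theta> * multinacci_orbit \<theta> n - 1"
  unfolding multinacci_orbit_def
  by (simp only: sum.lessThan_Suc_shift) (simp add: sum_distrib_left algebra_simps)

text \<open>
  Already the first step moves down by \<open>2 - \<theta>\<close>, and below \<open>1\<close> the steps
  \<open>(\<theta> - 1) * x - 1\<close> move down at least as far.
\<close>

lemma multinacci_orbit_le:
  assumes "1 \<le> \<theta>" "\<theta> \<le> 2"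
  shows "multinacci_orbit \<theta> n \<le> 1 - real n * (2 - \<theta>)"
proof (induction n)
  case (Suc n)
  have "0 \<le> real n * (2 - \<theta>)"
    using assms by simp
  with Suc have "multinacci_orbit \<theta> n \<le> 1"
    by linarith
  hence "(\<theta> - 1) * multinacci_orbit \<theta> n \<le> \<theta> - 1"
    using assms mult_left_mono[of "multinacci_orbit \<theta> n" 1 "\<theta> - 1"] by simp
  with Suc show ?case
    by (simp add: multinacci_orbit_Suc algebra_simps)
qed simp

lemma ell_le:
  assumes "n \<ge> 1" "\<forall>k\<le>n. s k \<in> {-1, 0, 1}" "(\<Sum>k=0..n. s k * \<theta> ^ k) \<noteq> 0"
  shows "ell \<theta> \<le> \<bar>\<Sum>k=0..n. s k * \<theta> ^ k\<bar>"
  unfolding ell_def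
  by (rule cInf_lower[OF _ ell_set_bdd_below]) (use assms in blast)

lemma ell_le_abs_multinacci_orbit:
  assumes "n \<ge> 1" "multinacci_orbit \<theta> n \<noteq> 0"
  shows "ell \<theta> \<le> \<bar>multinacci_orbit \<theta> n\<bar>"
proof -
  define s :: "nat \<Rightarrow> real" where "s k = (if k = n then 1 else -1)" for k
  have "(\<Sum>k=0..n. s k * \<theta> ^ k) = (\<Sum>k<n. s k * \<theta> ^ k) + s n * \<theta> ^ n"
    by (simp add: atLeast0AtMost lessThan_Suc_atMost[symmetric])
  also have "(\<Sum>k<n. s k * \<theta> ^ k) = (\<Sum>k<n. - (\<theta> ^ k))"
    by (intro sum.cong) (auto simp: s_def)
  finally have "(\<Sum>k=0..n. s k * \<theta> ^ k) = multinacci_orbit \<theta> n"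
    by (simp add: s_def multinacci_orbit_def sum_negf)
  with assms ell_le[of n s \<theta>] show ?thesis
    by (simp add: s_def)
qed

lemma power_mult_sum_inverse_powers:
  fixes \<theta> :: "'a :: field"
  assumes "\<theta> \<noteq> 0"
  shows "\<theta> ^ m * (\<Sum>k=1..m. inverse \<theta> ^ k) = (\<Sum>k<m. \<theta> ^ k)"
proof (induction m)
  case (Suc m)
  have "\<theta> ^ Suc m * (\<Sum>k=1..Suc m. inverse \<theta> ^ k)
      = \<theta> * (\<theta> ^ m * (\<Sum>k=1..m. inverse \<theta> ^ k)) + \<theta> ^ Suc m * inverse \<theta> ^ Suc m"
    by (simp add: algebra_simps)
  also have "\<theta> ^ Suc m * inverse \<theta> ^ Suc m = 1"
    using assms by (simp only: power_mult_distrib[symmetric]) simp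
  also have "\<theta> * (\<theta> ^ m * (\<Sum>k=1..m. inverse \<theta> ^ k)) + 1 = (\<Sum>k<Suc m. \<theta> ^ k)"
    unfolding Suc.IH by (simp only: sum.lessThan_Suc_shift) (simp add: sum_distrib_left)
  finally show ?case .
qed simp

lemma is_multinacci_if_sum_powers_eq_1:
  assumes "m \<ge> 2" "x > 0" "(\<Sum>k=1..m. x ^ k) = 1"
  shows "is_multinacci x"
  using assms the1_equality[OF multinacci_ex1, of m x]
  unfolding is_multinacci_def multinacci_def by auto

text \<open>
  Hitting \<open>1 / \<theta>\<close> means that the next value vanishes, which is the equation
  \<open>\<theta>^(n+1) = 1 + \<theta> + \<dots> + \<theta>^n\<close>; dividing it by \<open>\<theta>^(n+1)\<close> gives the multinacci
  equation of index \<open>n + 1\<close> for \<open>1 / \<theta>\<close>.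
\<close>

lemma is_multinacci_if_orbit_eq:
  assumes "\<theta> > 0" "n \<ge> 1" "multinacci_orbit \<theta> n = 1 / \<theta>"
  shows "is_multinacci (inverse \<theta>)"
proof -
  have "multinacci_orbit \<theta> (Suc n) = 0"
    using assms by (simp add: multinacci_orbit_Suc)
  hence "\<theta> ^ Suc n * (\<Sum>k=1..Suc n. inverse \<theta> ^ k) = \<theta> ^ Suc n"
    using assms by (subst power_mult_sum_inverse_powers) (simp_all add: multinacci_orbit_def)
  hence "(\<Sum>k=1..Suc n. inverse \<theta> ^ k) = 1"
    using assms by (metis mult_cancel_left2 power_not_zero less_irrefl)
  with assms show ?thesis
    by (intro is_multinacci_if_sum_powers_eq_1[of "Suc n"]) auto
qed

lemma is_multinacci_or_ell_le:
  assumes "1 < \<theta>" "\<theta> < 2"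
  shows "is_multinacci (inverse \<theta>) \<or> ell \<theta> \<le> 1 / (1 + \<theta>)"
proof -
  let ?x = "multinacci_orbit \<theta>"
  obtain j where "1 < real j * (2 - \<theta>)"
    using assms reals_Archimedean3[of "2 - \<theta>"] by auto
  with multinacci_orbit_le[of \<theta> j] assms have "?x j < 0"
    by simp
  also have "0 < 1 / \<theta>"
    using assms by simp
  finally have "\<exists>n. ?x n \<le> 1 / \<theta>"
    by (auto intro: less_imp_le)
  then obtain N where N: "?x N \<le> 1 / \<theta>" and before: "\<And>i. i < N \<Longrightarrow> ?x i > 1 / \<theta>"
    using exists_least_iff[of "\<lambda>n. ?x n \<le> 1 / \<theta>"] by (auto simp: not_le)
  have "N \<noteq> 0"
    using N assms by (intro notI) simp
  then obtain M where M: "N = Suc M"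
    using not0_implies_Suc by blast
  have pos: "?x N > 0"
    using before[of M] assms by (simp add: M multinacci_orbit_Suc field_simps)
  show ?thesis
  proof (cases "?x N = 1 / \<theta>")
    case True
    with is_multinacci_if_orbit_eq[of \<theta> N] assms M show ?thesis
      by simp
  next
    case False
    with N have "?x N < 1 / \<theta>"
      by simp
    hence neg: "?x (Suc N) < 0"
      using assms by (simp add: multinacci_orbit_Suc field_simps)
    show ?thesis
    proof (cases "?x N \<le> 1 / (1 + \<theta>)")
      case True
      with ell_le_abs_multinacci_orbit[of N \<theta>] pos M show ?thesis
        by simp
    next
      case False
      \<comment> \<open>\<open>1 / (1 + \<theta>)\<close> is the fixed point of \<open>x \<mapsto> 1 - \<theta> * x\<close>, which is decreasing.\<close>
      hence "\<theta> * (1 / (1 + \<theta>)) \<le> \<theta> * ?x N"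
        using assms by (intro mult_left_mono) auto
      moreover have "1 - \<theta> * (1 / (1 + \<theta>)) = 1 / (1 + \<theta>)"
        using assms by (simp add: field_simps)
      ultimately have "- ?x (Suc N) \<le> 1 / (1 + \<theta>)"
        by (simp add: multinacci_orbit_Suc)
      with ell_le_abs_multinacci_orbit[of "Suc N" \<theta>] neg show ?thesis
        by simp
    qed
  qed
qed

theorem corollary5p5:
  fixes \<theta> :: real
  assumes "3 / 2 < \<theta>" and "\<theta> < 2"
  shows "is_multinacci (inverse \<theta>) \<or> (ell \<theta> \<le> 2 / (2 + \<theta>) \<and> 2 / (2 + \<theta>) < 1 / \<theta>)"
proof -
  have "1 / (1 + \<theta>) \<le> 2 / (2 + \<theta>)" "2 / (2 + \<theta>) < 1 / \<theta>"
    using assms by (simp_all add: field_simps)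
  with is_multinacci_or_ell_le[of \<theta>] assms show ?thesis
    by linarith
qed

end
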